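(* Let $(\Omega,\mathscr{A},\mu)$ be a probability space with a filtration $\mathscr{A}_1\subset\mathscr{A}_2\subset\cdots\subset\mathscr{A}$ of sub-$\sigma$-algebras whose union generates $\mathscr{A}$. Let $a_0=0$ and $a_n=1-e^{-16^{n+1}}$ for $n\ge1$, and for $t>0$ let $$T^t=\sum_{n=1}^{\infty}(1-a_{n-1})^t\,dE_n=\sum_{n=1}^{\infty}\left[(1-a_{n-1})^t-(1-a_n)^t\right]E_n .$$ Then, pointwise almost everywhere, $$\sqrt{\tfrac{7}{60}}\;S(f-\mathrm{F}(f))\le G^T(f)\le\sqrt{\tfrac{23}{60}}\;S(f-\mathrm{F}(f)),\qquad\forall f\in L_1(\Omega,\mathscr{A},\mu).$$ Consequently, for $1\le p\le\infty$, $$\sqrt{\tfrac{7}{60}}\;\|S(f-\mathrm{F}(f))\|_p\le\|G^T(f)\|_p\le\sqrt{\tfrac{23}{60}}\;\|S(f-\mathrm{F}(f))\|_p,\qquad\forall f\in L_p(\Omega,\mathscr{A},\mu).$$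
   Context: For $f\in L_1(\Omega,\mathscr{A},\mu)$ and $n\ge 1$: $E_n(f)=E(f\mid\mathscr{A}_n)$, $E_0=0$ by convention, and $dE_n(f)=E_n(f)-E_{n-1}(f)$. The martingale square function is $$S(f)=\Big(\sum_{n=1}^\infty|dE_n(f)|^2\Big)^{1/2}.$$ The family $\{T^t\}_{t>0}$ is a semigroup of positive contractions on each $L_p(\Omega)$, $1\le p\le\infty$, and its Littlewood-Paley $g$-function is $$G^T(f)=\Big(\int_0^\infty\Big|t\frac{\partial}{\partial t}T^t(f)\Big|^2\frac{dt}{t}\Big)^{1/2}.$$ $\mathrm{F}$ denotes the projection onto the fixed point subspace of $\{T^t\}_{t>0}$; here $\mathrm{F}=E_1$. Norms $\|\cdot\|_p$ may take the value $+\infty$. *)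

theory Defs
  imports "HOL-Probability.Probability"
begin

section \<open>Martingale differences and the square function\<close>

text \<open>
  Functions are complex-valued; real-valued functions are the special case of vanishing imaginary
  part. The library provides \<^const>\<open>real_cond_exp\<close> only, so conditional expectation is taken
  separately on the real and imaginary parts. It picks one representative of each class modulo null
  sets, which is why all statements below are of the almost-everywhere kind.
\<close>

definition complex_cond_exp :: "'a measure \<Rightarrow> 'a measure \<Rightarrow> ('a \<Rightarrow> complex) \<Rightarrow> 'a \<Rightarrow> complex" where
  "complex_cond_exp M B f x =
     Complex (real_cond_exp M B (\<lambda>y. Re (f y)) x) (real_cond_exp M B (\<lambda>y. Im (f y)) x)"

text \<open>The filtration is indexed by the positive integers; \<open>A 0\<close> is never used.\<close>

definition generating_filtration :: "'a measure \<Rightarrow> (nat \<Rightarrow> 'a measure) \<Rightarrow> bool" where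
  "generating_filtration M A \<longleftrightarrow>
     (\<forall>n\<ge>1. subalgebra M (A n)) \<and>
     (\<forall>n\<ge>1. sets (A n) \<subseteq> sets (A (Suc n))) \<and>
     sigma_sets (space M) (\<Union>n\<in>{1..}. sets (A n)) = sets M"

definition mart_E :: "'a measure \<Rightarrow> (nat \<Rightarrow> 'a measure) \<Rightarrow> nat \<Rightarrow> ('a \<Rightarrow> complex) \<Rightarrow> 'a \<Rightarrow> complex" where
  "mart_E M A n f x = (if n = 0 then 0 else complex_cond_exp M (A n) f x)"

definition mart_dE :: "'a measure \<Rightarrow> (nat \<Rightarrow> 'a measure) \<Rightarrow> nat \<Rightarrow> ('a \<Rightarrow> complex) \<Rightarrow> 'a \<Rightarrow> complex" where
  "mart_dE M A n f x = mart_E M A n f x - mart_E M A (n - 1) f x"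

text \<open>Powers on \<open>[0,\<infinity>]\<close> with a positive real exponent, where \<open>\<infinity>\<close> is sent to \<open>\<infinity>\<close>.\<close>

definition epowr :: "ennreal \<Rightarrow> real \<Rightarrow> ennreal" where
  "epowr z r = (if z = \<top> then \<top> else ennreal (enn2real z powr r))"

text \<open>The sum over \<open>n \<ge> 1\<close> is written as a sum over all naturals of the terms of index \<open>Suc n\<close>,
  here and in the semigroup below.\<close>

definition square_fun :: "'a measure \<Rightarrow> (nat \<Rightarrow> 'a measure) \<Rightarrow> ('a \<Rightarrow> complex) \<Rightarrow> 'a \<Rightarrow> ennreal" where
  "square_fun M A f x = epowr (\<Sum>n. ennreal ((norm (mart_dE M A (Suc n) f x))\<^sup>2)) (1/2)"

section \<open>The semigroup and its Littlewood-Paley function\<close>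

definition coeff_a :: "nat \<Rightarrow> real" where
  "coeff_a n = (if n = 0 then 0 else 1 - exp (- (16 ^ (n + 1))))"

text \<open>The representative of \<open>T\<^sup>t f\<close> is the pointwise sum of the series; for almost every point it
  converges for all \<open>t > 0\<close> simultaneously and is differentiable in \<open>t\<close>.\<close>

definition semigroup_T :: "'a measure \<Rightarrow> (nat \<Rightarrow> 'a measure) \<Rightarrow> real \<Rightarrow> ('a \<Rightarrow> complex) \<Rightarrow> 'a \<Rightarrow> complex" where
  "semigroup_T M A t f x = (\<Sum>n. ((1 - coeff_a n) powr t) *\<^sub>R mart_dE M A (Suc n) f x)"

definition G_fun :: "'a measure \<Rightarrow> (nat \<Rightarrow> 'a measure) \<Rightarrow> ('a \<Rightarrow> complex) \<Rightarrow> 'a \<Rightarrow> ennreal" where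
  "G_fun M A f x =
     epowr (\<integral>\<^sup>+t\<in>{0<..}. ennreal
       ((norm (t *\<^sub>R vector_derivative (\<lambda>s. semigroup_T M A s f x) (at t)))\<^sup>2 / t) \<partial>lborel) (1/2)"

text \<open>The projection onto the fixed point subspace of \<open>(T\<^sup>t)\<close>, which for this semigroup is the
  first conditional expectation; see \<open>fix_proj_idem\<close> and \<open>fix_proj_iff_fixed_point\<close> below.\<close>

definition fix_proj :: "'a measure \<Rightarrow> (nat \<Rightarrow> 'a measure) \<Rightarrow> ('a \<Rightarrow> complex) \<Rightarrow> 'a \<Rightarrow> complex" where
  "fix_proj M A f = mart_E M A 1 f"

section \<open>Norms\<close>

definition Lp_norm :: "'a measure \<Rightarrow> ennreal \<Rightarrow> ('a \<Rightarrow> ennreal) \<Rightarrow> ennreal" where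
  "Lp_norm M p g =
     (if p = \<top> then esssup M g
      else epowr (\<integral>\<^sup>+x. epowr (g x) (enn2real p) \<partial>M) (1 / enn2real p))"

definition Lp_space :: "'a measure \<Rightarrow> ennreal \<Rightarrow> ('a \<Rightarrow> complex) set" where
  "Lp_space M p =
     {f. f \<in> borel_measurable M \<and> Lp_norm M p (\<lambda>x. ennreal (norm (f x))) < \<top>}"

section \<open>The fixed points of the semigroup\<close>

context
  fixes M :: "'a measure" and A :: "nat \<Rightarrow> 'a measure"
  assumes prob: "prob_space M" and filt: "generating_filtration M A"
begin

lemma subalg: "n \<ge> 1 \<Longrightarrow> subalgebra M (A n)"
  using filt by (simp add: generating_filtration_def)

lemma subalg_fst: "n \<ge> 1 \<Longrightarrow> subalgebra (A n) (A 1)"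
proof (induction n rule: nat_induct_at_least)
  case base
  then show ?case by (simp add: subalgebra_def)
next
  case (Suc n)
  then show ?case
    using filt subalg[of n] subalg[of "Suc n"]
    unfolding subalgebra_def generating_filtration_def by fastforce
qed

lemma sigma_finite_A:
  assumes "n \<ge> 1"
  shows "sigma_finite_subalgebra M (A n)"
proof -
  interpret prob_space M by (rule prob)
  interpret finite_measure_subalgebra M "A n"
    using subalg[OF assms] by unfold_locales
  show ?thesis by (rule sigma_finite_subalgebra_axioms)
qed

lemma mart_E_measurable [measurable]: "mart_E M A n f \<in> borel_measurable M"
proof (cases "n = 0")
  case False
  then interpret S: sigma_finite_subalgebra M "A n" using sigma_finite_A by simp
  have "mart_E M A n f = (\<lambda>x. of_real (real_cond_exp M (A n) (\<lambda>y. Re (f y)) x)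
      + \<i> * of_real (real_cond_exp M (A n) (\<lambda>y. Im (f y)) x))"
    using False by (simp add: mart_E_def complex_cond_exp_def Complex_eq fun_eq_iff)
  then show ?thesis by simp
qed (simp add: mart_E_def[abs_def])

lemma real_cond_exp_L1:
  assumes "n \<ge> 1" and u: "integrable M u"
  shows "(\<integral>\<^sup>+x. ennreal \<bar>real_cond_exp M (A n) u x\<bar> \<partial>M) \<le> (\<integral>\<^sup>+x. ennreal \<bar>u x\<bar> \<partial>M)"
proof -
  interpret S: sigma_finite_subalgebra M "A n" using sigma_finite_A assms by simp
  have [measurable]: "u \<in> borel_measurable M" using u by simp
  have "(\<integral>\<^sup>+x. ennreal \<bar>real_cond_exp M (A n) u x\<bar> \<partial>M)
        \<le> (\<integral>\<^sup>+x. nn_cond_exp M (A n) (\<lambda>x. ennreal \<bar>u x\<bar>) x \<partial>M)"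
    by (intro nn_integral_mono_AE S.real_cond_exp_abs) simp
  also have "\<dots> = (\<integral>\<^sup>+x. 1 * nn_cond_exp M (A n) (\<lambda>x. ennreal \<bar>u x\<bar>) x \<partial>M)" by simp
  also have "\<dots> = (\<integral>\<^sup>+x. 1 * ennreal \<bar>u x\<bar> \<partial>M)"
    by (intro S.nn_cond_exp_intg) auto
  finally show ?thesis by simp
qed

lemma mart_E_L1:
  assumes f: "integrable M f"
  shows "(\<integral>\<^sup>+x. ennreal (norm (mart_E M A n f x)) \<partial>M) \<le> 2 * (\<integral>\<^sup>+x. ennreal (norm (f x)) \<partial>M)"
proof (cases "n = 0")
  case False
  then interpret S: sigma_finite_subalgebra M "A n" using sigma_finite_A by simp
  have "(\<integral>\<^sup>+x. ennreal (norm (mart_E M A n f x)) \<partial>M) \<le>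
     (\<integral>\<^sup>+x. ennreal \<bar>real_cond_exp M (A n) (\<lambda>y. Re (f y)) x\<bar>
         + ennreal \<bar>real_cond_exp M (A n) (\<lambda>y. Im (f y)) x\<bar> \<partial>M)"
    using False by (intro nn_integral_mono) (auto simp: mart_E_def complex_cond_exp_def
      simp flip: ennreal_plus intro!: ennreal_leI order_trans[OF cmod_le])
  also have "\<dots> = (\<integral>\<^sup>+x. ennreal \<bar>real_cond_exp M (A n) (\<lambda>y. Re (f y)) x\<bar> \<partial>M)
         + (\<integral>\<^sup>+x. ennreal \<bar>real_cond_exp M (A n) (\<lambda>y. Im (f y)) x\<bar> \<partial>M)"
    by (intro nn_integral_add) auto
  also have "\<dots> \<le> (\<integral>\<^sup>+x. ennreal \<bar>Re (f x)\<bar> \<partial>M) + (\<integral>\<^sup>+x. ennreal \<bar>Im (f x)\<bar> \<partial>M)"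
    using False f by (intro add_mono real_cond_exp_L1) auto
  also have "\<dots> \<le> (\<integral>\<^sup>+x. ennreal (norm (f x)) \<partial>M) + (\<integral>\<^sup>+x. ennreal (norm (f x)) \<partial>M)"
    by (intro add_mono nn_integral_mono ennreal_leI abs_Re_le_cmod abs_Im_le_cmod)
  finally show ?thesis by (simp add: mult_2)
qed (simp add: mart_E_def)

lemma mart_dE_L1:
  assumes f: "integrable M f"
  shows "(\<integral>\<^sup>+x. ennreal (norm (mart_dE M A n f x)) \<partial>M) \<le> 4 * (\<integral>\<^sup>+x. ennreal (norm (f x)) \<partial>M)"
proof -
  have "(\<integral>\<^sup>+x. ennreal (norm (mart_dE M A n f x)) \<partial>M) \<le>
    (\<integral>\<^sup>+x. ennreal (norm (mart_E M A n f x)) + ennreal (norm (mart_E M A (n-1) f x)) \<partial>M)"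
    by (intro nn_integral_mono) (auto simp: mart_dE_def
      simp flip: ennreal_plus intro!: ennreal_leI norm_triangle_ineq4)
  also have "\<dots> = (\<integral>\<^sup>+x. ennreal (norm (mart_E M A n f x)) \<partial>M)
      + (\<integral>\<^sup>+x. ennreal (norm (mart_E M A (n-1) f x)) \<partial>M)"
    by (intro nn_integral_add) auto
  also have "\<dots> \<le> 2 * (\<integral>\<^sup>+x. ennreal (norm (f x)) \<partial>M) + 2 * (\<integral>\<^sup>+x. ennreal (norm (f x)) \<partial>M)"
    by (intro add_mono mart_E_L1 f)
  finally show ?thesis by (simp flip: distrib_right)
qed

lemma one_minus_coeff_a: "1 - coeff_a n = (if n = 0 then 1 else exp (- (16 ^ (n + 1))))"
  by (simp add: coeff_a_def)

lemma one_minus_coeff_a_le: "1 - coeff_a n \<le> exp (-1) ^ n"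
proof -
  have "real n < 2 ^ n" by (rule of_nat_less_two_power)
  also have "(2 :: real) ^ n \<le> 16 ^ n" by (intro power_mono) auto
  also have "\<dots> \<le> 16 ^ (n + 1)" by simp
  finally have "real n \<le> 16 ^ (n + 1)" by simp
  then show ?thesis
    by (simp add: one_minus_coeff_a flip: exp_of_nat_mult)
qed

lemma AE_summable_1:
  assumes f: "integrable M f"
  shows "AE x in M. summable (\<lambda>n. (1 - coeff_a n) * norm (mart_dE M A (Suc n) f x))"
proof -
  have [measurable]: "mart_dE M A n f \<in> borel_measurable M" for n
    unfolding mart_dE_def[abs_def] by simp
  have nn: "0 \<le> 1 - coeff_a n" for n by (simp add: one_minus_coeff_a)
  define I where "I = (\<integral>\<^sup>+x. ennreal (norm (f x)) \<partial>M)"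
  have I: "I < \<top>" using f by (simp add: I_def integrable_iff_bounded)
  have "(\<integral>\<^sup>+x. (\<Sum>n. ennreal ((1 - coeff_a n) * norm (mart_dE M A (Suc n) f x))) \<partial>M)
     = (\<Sum>n. \<integral>\<^sup>+x. ennreal ((1 - coeff_a n) * norm (mart_dE M A (Suc n) f x)) \<partial>M)"
    by (intro nn_integral_suminf) auto
  also have "\<dots> = (\<Sum>n. ennreal (1 - coeff_a n) * (\<integral>\<^sup>+x. ennreal (norm (mart_dE M A (Suc n) f x)) \<partial>M))"
    using nn by (subst nn_integral_cmult[symmetric]) (auto simp: ennreal_mult)
  also have "\<dots> \<le> (\<Sum>n. ennreal (exp (-1) ^ n) * (4 * I))"
    unfolding I_def
    by (intro suminf_le mult_mono ennreal_leI mart_dE_L1 f one_minus_coeff_a_le) auto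
  also have "\<dots> = ennreal (\<Sum>n. exp (-1) ^ n) * (4 * I)"
    by (subst ennreal_suminf_multc, subst suminf_ennreal2) (auto intro!: summable_geometric)
  also have "\<dots> < \<top>" using I by (simp add: ennreal_mult_less_top)
  finally have "AE x in M. (\<Sum>n. ennreal ((1 - coeff_a n) * norm (mart_dE M A (Suc n) f x))) \<noteq> \<infinity>"
    by (intro nn_integral_noteq_infinite) auto
  then show ?thesis
    by eventually_elim (use nn in \<open>auto intro!: summable_suminf_not_top\<close>)
qed

lemma mart_E_cong:
  assumes "AE x in M. f x = g x" "integrable M f" "integrable M g"
  shows "AE x in M. mart_E M A n f x = mart_E M A n g x"
proof (cases "n = 0")
  case False
  then interpret S: sigma_finite_subalgebra M "A n" using sigma_finite_A by simp
  have "AE x in M. real_cond_exp M (A n) (\<lambda>y. Re (f y)) x = real_cond_exp M (A n) (\<lambda>y. Re (g y)) x"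
       "AE x in M. real_cond_exp M (A n) (\<lambda>y. Im (f y)) x = real_cond_exp M (A n) (\<lambda>y. Im (g y)) x"
    using assms by (intro S.real_cond_exp_cong; auto)+
  then show ?thesis
    by eventually_elim (simp add: mart_E_def complex_cond_exp_def)
qed (simp add: mart_E_def)

lemma mart_E_fix_proj:
  assumes f: "integrable M f" and n: "n \<ge> 1"
  shows "AE x in M. mart_E M A n (fix_proj M A f) x = fix_proj M A f x"
proof -
  interpret S: sigma_finite_subalgebra M "A n" using sigma_finite_A n by simp
  interpret S1: sigma_finite_subalgebra M "A 1" using sigma_finite_A by simp
  have "AE x in M. real_cond_exp M (A n) (real_cond_exp M (A 1) u) x = real_cond_exp M (A 1) u x"
    if "integrable M u" for u
    using that subalg_fst[OF n]
    by (intro S.real_cond_exp_F_meas) (auto simp del: One_nat_def intro: S1.real_cond_exp_int measurable_from_subalg)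
  from this[of "\<lambda>x. Re (f x)"] this[of "\<lambda>x. Im (f x)"] f
  have "AE x in M. real_cond_exp M (A n) (real_cond_exp M (A 1) (\<lambda>x. Re (f x))) x = real_cond_exp M (A 1) (\<lambda>x. Re (f x)) x"
       "AE x in M. real_cond_exp M (A n) (real_cond_exp M (A 1) (\<lambda>x. Im (f x))) x = real_cond_exp M (A 1) (\<lambda>x. Im (f x)) x"
    by auto
  then show ?thesis
    by eventually_elim (use n in \<open>simp add: fix_proj_def mart_E_def complex_cond_exp_def cong del: if_weak_cong\<close>)
qed

lemma integrable_fix_proj:
  assumes f: "integrable M f"
  shows "integrable M (fix_proj M A f)"
proof -
  have "(\<integral>\<^sup>+x. ennreal (norm (f x)) \<partial>M) < \<top>" using f by (simp add: integrable_iff_bounded)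
  then have "2 * (\<integral>\<^sup>+x. ennreal (norm (f x)) \<partial>M) < \<top>" by (simp add: ennreal_mult_less_top)
  then show ?thesis
    using mart_E_L1[OF f, of 1] unfolding fix_proj_def
    by (auto simp: integrable_iff_bounded intro: le_less_trans)
qed

lemma semigroup_T_fix_proj:
  assumes f: "integrable M f" and eq: "AE x in M. fix_proj M A f x = f x"
  shows "AE x in M. semigroup_T M A t f x = f x"
proof -
  have "AE x in M. \<forall>n. mart_E M A (Suc n) f x = f x"
    unfolding AE_all_countable
  proof
    fix n
    have "AE x in M. mart_E M A (Suc n) (fix_proj M A f) x = fix_proj M A f x"
      using mart_E_fix_proj f by simp
    moreover have "AE x in M. mart_E M A (Suc n) (fix_proj M A f) x = mart_E M A (Suc n) f x"
      using mart_E_cong eq f integrable_fix_proj by simp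
    ultimately show "AE x in M. mart_E M A (Suc n) f x = f x"
      using eq by eventually_elim simp
  qed
  then show ?thesis
  proof eventually_elim
    case (elim x)
    have "mart_dE M A (Suc n) f x = (if n = 0 then f x else 0)" for n
      using elim[rule_format, of n] elim[rule_format, of "n - 1"]
      by (cases n) (auto simp: mart_dE_def mart_E_def[of _ _ 0])
    then have "semigroup_T M A t f x = (\<Sum>n. if n = 0 then f x else 0)"
      unfolding semigroup_T_def by (intro suminf_cong) (auto simp: coeff_a_def)
    also have "\<dots> = f x"
      using suminf_finite[of "{0}" "\<lambda>n. if n = 0 then f x else 0"] by simp
    finally show ?case .
  qed
qed

lemma fix_proj_semigroup_T:
  assumes f: "integrable M f" and eq: "\<And>t. t > 0 \<Longrightarrow> AE x in M. semigroup_T M A t f x = f x"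
  shows "AE x in M. fix_proj M A f x = f x"
proof -
  have "AE x in M. \<forall>k. semigroup_T M A (real (Suc k)) f x = f x"
    unfolding AE_all_countable by (intro allI eq) simp
  with AE_summable_1[OF f] show ?thesis
  proof eventually_elim
    case (elim x)
    define c where "c n = 1 - coeff_a n" for n
    define d where "d n = mart_dE M A (Suc n) f x" for n
    have c0: "c 0 = 1" and c_pos: "0 < c n" for n
      by (auto simp: c_def one_minus_coeff_a)
    have c_le: "c (Suc n) \<le> c 1" for n
      by (auto simp: c_def one_minus_coeff_a intro: power_increasing)
    have c1: "c 1 < 1" by (simp add: c_def one_minus_coeff_a)
    have sm: "summable (\<lambda>n. c n * norm (d n))" using elim by (simp add: c_def d_def)
    then have sm': "summable (\<lambda>n. c (Suc n) * norm (d (Suc n)))" by (subst summable_Suc_iff)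
    define B where "B = (\<Sum>n. c (Suc n) * norm (d (Suc n)))"
    have bd: "norm (f x - d 0) \<le> c 1 ^ k * B" for k
    proof -
      have le: "norm (c (Suc n) powr real (Suc k) *\<^sub>R d (Suc n)) \<le> c 1 ^ k * (c (Suc n) * norm (d (Suc n)))" for n
      proof -
        have "c (Suc n) powr real (Suc k) = c (Suc n) ^ k * c (Suc n)"
          using c_pos by (simp add: powr_realpow del: of_nat_Suc)
        also have "\<dots> \<le> c 1 ^ k * c (Suc n)"
          using c_le c_pos by (intro mult_right_mono power_mono) (auto intro: less_imp_le)
        finally show ?thesis
          by (simp add: mult_right_mono mult.assoc flip: mult.assoc)
      qed
      have sm2: "summable (\<lambda>n. norm (c (Suc n) powr real (Suc k) *\<^sub>R d (Suc n)))"
        by (rule summable_comparison_test'[OF summable_mult[OF sm', of "c 1 ^ k"]]) (use le in auto)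
      have "summable (\<lambda>n. c (Suc n) powr real (Suc k) *\<^sub>R d (Suc n))"
        using sm2 by (rule summable_norm_cancel)
      then have "summable (\<lambda>n. c n powr real (Suc k) *\<^sub>R d n)"
        by (subst (asm) summable_Suc_iff)
      then have "semigroup_T M A (real (Suc k)) f x - d 0 = (\<Sum>n. c (Suc n) powr real (Suc k) *\<^sub>R d (Suc n))"
        using suminf_split_head[of "\<lambda>n. c n powr real (Suc k) *\<^sub>R d n"]
        by (simp add: semigroup_T_def c_def d_def coeff_a_def[of 0])
      then have "norm (f x - d 0) \<le> (\<Sum>n. norm (c (Suc n) powr real (Suc k) *\<^sub>R d (Suc n)))"
        using elim summable_norm[OF sm2] by metis
      also have "\<dots> \<le> (\<Sum>n. c 1 ^ k * (c (Suc n) * norm (d (Suc n))))"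
        by (intro suminf_le le sm2 summable_mult sm')
      also have "\<dots> = c 1 ^ k * B"
        unfolding B_def by (rule suminf_mult[OF sm'])
      finally show ?thesis .
    qed
    have "(\<lambda>k. c 1 ^ k * B) \<longlonglongrightarrow> 0 * B"
      using c1 c_pos[of 1] by (intro tendsto_mult LIMSEQ_realpow_zero) auto
    then have "norm (f x - d 0) \<le> 0 * B"
      by (rule LIMSEQ_le_const) (use bd in auto)
    then show ?case by (simp add: d_def fix_proj_def mart_dE_def mart_E_def[of _ _ 0])
  qed
qed

lemma fix_proj_idem:
  assumes "integrable M f"
  shows "AE x in M. fix_proj M A (fix_proj M A f) x = fix_proj M A f x"
  using mart_E_fix_proj[OF assms, of 1] unfolding fix_proj_def[of M A "fix_proj M A f"] by simp

lemma fix_proj_iff_fixed_point: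
  assumes "integrable M f"
  shows "(AE x in M. fix_proj M A f x = f x) \<longleftrightarrow> (\<forall>t>0. AE x in M. semigroup_T M A t f x = f x)"
  using semigroup_T_fix_proj[OF assms] fix_proj_semigroup_T[OF assms] by blast

end

end

theory Submission
  imports Defs "HOL-Real_Asymp.Real_Asymp"
begin

text \<open>
  Write \<open>1 - a\<^sub>n = exp (- L\<^sub>n)\<close>, so that \<open>L\<^sub>0 = 0\<close> and \<open>L\<^sub>n = 16\<^sup>n\<^sup>+\<^sup>1\<close> for \<open>n \<ge> 1\<close>.
  Pointwise, \<open>T\<^sup>t f\<close> is the exponential series with frequencies \<open>L\<^sub>n\<close> and coefficients
  \<open>d\<^sub>n = dE\<^sub>n\<^sub>+\<^sub>1 f\<close>, and expanding the square of its derivative turns \<open>G(f)\<^sup>2\<close> into the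
  quadratic form with kernel \<open>L\<^sub>n L\<^sub>m / (L\<^sub>n + L\<^sub>m)\<^sup>2\<close> over \<open>n, m \<ge> 1\<close>. On the diagonal
  the kernel is \<open>1/4\<close>; off the diagonal it is at most \<open>16\<close> to the power \<open>-\<bar>n - m\<bar>\<close>, with row
  sums at most \<open>2/15\<close>. Schur's test gives the constants \<open>1/4 - 2/15 = 7/60\<close> and
  \<open>1/4 + 2/15 = 23/60\<close>.

  For infinite sums the upper bound follows from Fatou's lemma. The lower bound must also cover the
  case \<open>S = \<infinity>\<close>: damping the coefficients to \<open>exp (- s L\<^sub>n) d\<^sub>n\<close> amounts to translating the
  integrand by \<open>s\<close>, which only decreases the integral against \<open>t dt\<close>; dominated convergence
  applies to the damped series, and then \<open>s\<close> tends to \<open>0\<close>.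
\<close>

section \<open>The quadratic form of the frequencies\<close>

text \<open>Passing from \<open>n\<close> to \<open>Suc n\<close> applies the map taking
  \<open>s\<close> to \<open>(s + 1) / 16\<close>, whose fixed point is 1/15, so the bound is
  preserved.\<close>

lemma sum_pow_dist_left: "(\<Sum>m<n. (1/16::real) ^ (n - m)) \<le> 1/15"
proof (induction n)
  case (Suc n)
  have "(\<Sum>m<Suc n. (1/16::real) ^ (Suc n - m)) = 1/16 * ((\<Sum>m<n. (1/16) ^ (n - m)) + 1)"
    by (simp add: sum_distrib_left Suc_diff_le distrib_left)
  then show ?case using Suc by simp
qed simp

lemma sum_pow_dist_right: "(\<Sum>m\<in>{n<..<N}. (1/16::real) ^ (m - n)) \<le> 1/15"
proof -
  have "(\<Sum>m\<in>{n<..<N}. (1/16::real) ^ (m - n)) = (\<Sum>k<N - Suc n. (1/16) ^ (Suc k))"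
    by (rule sum.reindex_bij_witness[of _ "\<lambda>k. n + Suc k" "\<lambda>m. m - Suc n"])
       (auto simp: less_diff_conv Suc_diff_Suc simp flip: power_Suc)
  also have "\<dots> = 1/16 * (\<Sum>k<N - Suc n. (1/16) ^ k)"
    by (simp add: sum_distrib_left)
  also have "\<dots> \<le> 1/16 * (\<Sum>k. (1/16) ^ k)"
    by (intro mult_left_mono sum_le_suminf summable_geometric) auto
  also have "\<dots> = 1/15"
    by (subst suminf_geometric) auto
  finally show ?thesis .
qed

text \<open>Schur's test: Cauchy-Schwarz and the arithmetic-geometric mean inequality replace each
  inner product by half the sum of two squares, and the symmetry of \<open>K\<close> makes both
  halves equal to a sum weighted by row sums.\<close>

lemma schur_bound:
  fixes x :: "nat \<Rightarrow> 'b::real_inner" and K :: "nat \<Rightarrow> nat \<Rightarrow> real"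
  assumes K: "\<And>n m. 0 \<le> K n m" "\<And>n m. K n m = K m n"
    and row: "\<And>n. (\<Sum>m<N. K n m) \<le> B"
  shows "\<bar>\<Sum>n<N. \<Sum>m<N. K n m * (x n \<bullet> x m)\<bar> \<le> B * (\<Sum>n<N. (norm (x n))\<^sup>2)"
proof -
  have "\<bar>\<Sum>n<N. \<Sum>m<N. K n m * (x n \<bullet> x m)\<bar> \<le> (\<Sum>n<N. \<Sum>m<N. \<bar>K n m * (x n \<bullet> x m)\<bar>)"
    by (intro order_trans[OF sum_abs] sum_mono) auto
  also have "\<dots> \<le> (\<Sum>n<N. \<Sum>m<N. K n m * (((norm (x n))\<^sup>2 + (norm (x m))\<^sup>2) / 2))"
  proof (intro sum_mono)
    fix n m
    have "\<bar>x n \<bullet> x m\<bar> \<le> norm (x n) * norm (x m)" by (rule Cauchy_Schwarz_ineq2)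
    also have "\<dots> \<le> ((norm (x n))\<^sup>2 + (norm (x m))\<^sup>2) / 2"
      using sum_squares_bound[of "norm (x n)" "norm (x m)"] by simp
    finally show "\<bar>K n m * (x n \<bullet> x m)\<bar> \<le> K n m * (((norm (x n))\<^sup>2 + (norm (x m))\<^sup>2) / 2)"
      using mult_left_mono[OF _ K(1)[of n m]] K(1)[of n m] by (simp only: abs_mult abs_of_nonneg)
  qed
  also have "\<dots> = (\<Sum>n<N. \<Sum>m<N. K n m * (norm (x n))\<^sup>2) / 2 + (\<Sum>n<N. \<Sum>m<N. K n m * (norm (x m))\<^sup>2) / 2"
    by (simp add: sum.distrib distrib_left add_divide_distrib sum_divide_distrib)
  also have "(\<Sum>n<N. \<Sum>m<N. K n m * (norm (x m))\<^sup>2) = (\<Sum>n<N. \<Sum>m<N. K n m * (norm (x n))\<^sup>2)"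
    by (subst sum.swap) (simp add: K(2))
  also have "(\<Sum>n<N. \<Sum>m<N. K n m * (norm (x n))\<^sup>2) / 2 + (\<Sum>n<N. \<Sum>m<N. K n m * (norm (x n))\<^sup>2) / 2
      = (\<Sum>n<N. (\<Sum>m<N. K n m) * (norm (x n))\<^sup>2)"
    by (simp add: sum_distrib_right)
  also have "\<dots> \<le> (\<Sum>n<N. B * (norm (x n))\<^sup>2)"
    by (intro sum_mono mult_right_mono row) auto
  finally show ?thesis by (simp add: sum_distrib_left)
qed

definition freq :: "nat \<Rightarrow> real" where
  "freq n = (if n = 0 then 0 else 16 ^ (n + 1))"

lemma freq_Suc: "freq (Suc n) = 16 ^ (n + 2)"
  by (simp add: freq_def)

lemma freq_Suc_pos [simp]: "0 < freq (Suc n)"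
  by (simp add: freq_def)

lemma freq_nonneg [simp]: "0 \<le> freq n"
  by (simp add: freq_def)

lemma freq_Suc_neq_0 [simp]: "freq (Suc n) \<noteq> 0"
  by (simp add: freq_def)

text \<open>This linear growth is all that the general lemmas on exponential series ask of their
  frequencies \<open>L\<close>. It also gives \<open>1 \<le> freq (Suc n)\<close>, hence a common
  decay factor \<open>exp (- t)\<close>.\<close>

lemma freq_ge: "real n \<le> freq n"
proof -
  have "real n < 2 ^ n" by (rule of_nat_less_two_power)
  also have "(2 :: real) ^ n \<le> 16 ^ n" by (intro power_mono) auto
  also have "\<dots> \<le> 16 ^ (n + 1)" by simp
  finally show ?thesis by (simp add: freq_def)
qed

lemma powr_freq: "(1 - coeff_a n) powr t = exp (- (t * freq n))"
  by (simp add: coeff_a_def freq_def exp_powr_real)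

text \<open>The kernel is homogeneous of degree 0, so it depends only on the ratio \<open>r\<close>
  of the two frequencies: it equals \<open>r / (r + 1)\<^sup>2\<close>, which is at most
  \<open>1 / r\<close>.\<close>

lemma freq_kernel_le:
  assumes "m < n"
  shows "freq (Suc n) * freq (Suc m) / (freq (Suc n) + freq (Suc m))\<^sup>2 \<le> (1/16) ^ (n - m)"
proof -
  define r :: real where "r = 16 ^ (n - m)"
  have r: "0 < r" by (simp add: r_def)
  have "freq (Suc n) = r * freq (Suc m)"
    using assms by (simp add: freq_Suc r_def flip: power_add)
  then have "freq (Suc n) * freq (Suc m) / (freq (Suc n) + freq (Suc m))\<^sup>2 =
      (freq (Suc m))\<^sup>2 * r / ((freq (Suc m))\<^sup>2 * (r + 1)\<^sup>2)"
    by (simp add: power2_eq_square algebra_simps)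
  also have "\<dots> = r / (r + 1)\<^sup>2"
    by (subst mult_divide_mult_cancel_left) auto
  also have "\<dots> \<le> 1 / r"
  proof -
    have "r * r \<le> 1 * (r + 1)\<^sup>2" using r by (simp add: power2_eq_square algebra_simps)
    then show ?thesis using r by (simp add: divide_le_eq le_divide_eq)
  qed
  finally show ?thesis by (simp add: r_def power_one_over)
qed

text \<open>The kernel comes from integrating \<open>t * exp (- (t * (a + b)))\<close> over the
  half-line, which gives \<open>1 / (a + b)\<^sup>2\<close>. The inner product of complex numbers is
  the real one, the real part of \<open>x n * cnj (x m)\<close>. Indices are shifted by one because
  \<open>freq 0 = 0\<close>.\<close>

definition freq_form :: "nat \<Rightarrow> (nat \<Rightarrow> complex) \<Rightarrow> real" where
  "freq_form N x = (\<Sum>n<N. \<Sum>m<N.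
     freq (Suc n) * freq (Suc m) / (freq (Suc n) + freq (Suc m))\<^sup>2 * (x n \<bullet> x m))"

lemma freq_form_bounds: "\<bar>freq_form N x - 1/4 * (\<Sum>n<N. (norm (x n))\<^sup>2)\<bar> \<le> 2/15 * (\<Sum>n<N. (norm (x n))\<^sup>2)"
proof -
  define K where "K n m = (if n = m then 0 else
    freq (Suc n) * freq (Suc m) / (freq (Suc n) + freq (Suc m))\<^sup>2)" for n m
  have K: "0 \<le> K n m" "K n m = K m n" for n m
    by (auto simp: K_def mult.commute add.commute)
  have row: "(\<Sum>m<N. K n m) \<le> 2/15" for n
  proof -
    \<comment> \<open>Schur's test wants the row bound for every \<open>n\<close>, also for
      \<open>n \<ge> N\<close>; enlarging the index set to all \<open>m < n\<close> avoids a case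
      distinction.\<close>
    have "(\<Sum>m<N. K n m) \<le> (\<Sum>m\<in>{..<n} \<union> ({n} \<union> {n<..<N}). K n m)"
      by (rule sum_mono2) (auto simp: K)
    also have "\<dots> = (\<Sum>m<n. K n m) + (\<Sum>m\<in>{n<..<N}. K n m)"
      by (subst sum.union_disjoint; auto)+ (simp add: K_def)
    also have "\<dots> \<le> (\<Sum>m<n. (1/16) ^ (n - m)) + (\<Sum>m\<in>{n<..<N}. (1/16) ^ (m - n))"
    proof (intro add_mono sum_mono)
      show "K n m \<le> (1/16) ^ (n - m)" if "m \<in> {..<n}" for m
        using that freq_kernel_le[of m n] by (simp add: K_def)
      show "K n m \<le> (1/16) ^ (m - n)" if "m \<in> {n<..<N}" for m
        using that freq_kernel_le[of n m] by (subst K(2)) (simp add: K_def)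
    qed
    also have "\<dots> \<le> 1/15 + 1/15"
      by (intro add_mono sum_pow_dist_left sum_pow_dist_right)
    finally show ?thesis by simp
  qed
  have split: "freq (Suc n) * freq (Suc m) / (freq (Suc n) + freq (Suc m))\<^sup>2 * (x n \<bullet> x m)
      = K n m * (x n \<bullet> x m) + (if n = m then 1/4 * (norm (x n))\<^sup>2 else 0)" for n m
    using freq_Suc_pos[of n]
    by (auto simp: K_def power2_norm_eq_inner simp flip: mult_2) (simp add: power2_eq_square)
  have "freq_form N x = (\<Sum>n<N. \<Sum>m<N. K n m * (x n \<bullet> x m)) + 1/4 * (\<Sum>n<N. (norm (x n))\<^sup>2)"
    unfolding freq_form_def split by (simp add: sum.distrib sum_distrib_left)
  then show ?thesis
    using schur_bound[of K N "2/15" x, OF K row] by simp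
qed

section \<open>Integrals of finite exponential sums\<close>

lemma has_bochner_integral_t_exp:
  assumes a: "0 < a"
  shows "has_bochner_integral lborel (\<lambda>t::real. indicator {0<..} t * (t * exp (- (t * a)))) (1 / a\<^sup>2)"
proof (rule has_bochner_integral_nn_integral)
  have "(\<integral>\<^sup>+t. ennreal (indicator {0<..} t * (t * exp (- (t * a)))) \<partial>lborel)
      = (\<integral>\<^sup>+t. ennreal (t * exp (- (t * a))) * indicator {0..} t \<partial>lborel)"
    by (intro nn_integral_cong) (auto simp: indicator_def)
  also have "\<dots> = 0 - (- (0 / a + 1 / a\<^sup>2) * exp (- (0 * a)))"
  proof (rule nn_integral_FTC_atLeast)
    show "((\<lambda>t. - (t / a + 1 / a\<^sup>2) * exp (- (t * a))) has_real_derivative t * exp (- (t * a))) (at t)" for t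
      using a by (auto intro!: derivative_eq_intros simp: field_simps power2_eq_square)
    show "((\<lambda>t. - (t / a + 1 / a\<^sup>2) * exp (- (t * a))) \<longlongrightarrow> 0) at_top"
      using a by real_asymp
  qed (auto)
  finally show "(\<integral>\<^sup>+t. ennreal (indicator {0<..} t * (t * exp (- (t * a)))) \<partial>lborel) = ennreal (1 / a\<^sup>2)"
    by simp
qed (auto simp: indicator_def)

text \<open>The square is expanded into a double sum and integrated term by term. Mixed terms can be
  negative, so this is done with the Bochner integral and converted only at the end.\<close>

lemma nn_integral_exp_sum:
  "(\<integral>\<^sup>+t\<in>{0<..}. ennreal (t * (norm (\<Sum>n<N. (freq (Suc n) * exp (- (t * freq (Suc n)))) *\<^sub>R x n))\<^sup>2) \<partial>lborel)
     = ennreal (freq_form N x)"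
proof -
  let ?F = "\<lambda>t. \<Sum>n<N. (freq (Suc n) * exp (- (t * freq (Suc n)))) *\<^sub>R x n"
  have "has_bochner_integral lborel (\<lambda>t. \<Sum>n<N. \<Sum>m<N. (freq (Suc n) * freq (Suc m) * (x n \<bullet> x m)) *
     (indicator {0<..} t * (t * exp (- (t * (freq (Suc n) + freq (Suc m)))))))
     (\<Sum>n<N. \<Sum>m<N. (freq (Suc n) * freq (Suc m) * (x n \<bullet> x m)) * (1 / (freq (Suc n) + freq (Suc m))\<^sup>2))"
    by (intro has_bochner_integral_sum has_bochner_integral_mult_right has_bochner_integral_t_exp add_pos_pos freq_Suc_pos)
  also have "(\<lambda>t. \<Sum>n<N. \<Sum>m<N. (freq (Suc n) * freq (Suc m) * (x n \<bullet> x m)) *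
     (indicator {0<..} t * (t * exp (- (t * (freq (Suc n) + freq (Suc m)))))))
     = (\<lambda>t. indicator {0<..} t * (t * (norm (?F t))\<^sup>2))"
    by (auto simp: fun_eq_iff power2_norm_eq_inner inner_sum_left inner_sum_right sum_distrib_left
      inner_commute[of "x _" "x _"] distrib_left exp_add mult_ac exp_diff exp_minus inverse_eq_divide intro!: sum.cong)
  finally have *: "has_bochner_integral lborel (\<lambda>t. indicator {0<..} t * (t * (norm (?F t))\<^sup>2)) (freq_form N x)"
    by (simp add: freq_form_def mult_ac)
  have "(\<integral>\<^sup>+t\<in>{0<..}. ennreal (t * (norm (?F t))\<^sup>2) \<partial>lborel) =
      (\<integral>\<^sup>+t. ennreal (indicator {0<..} t * (t * (norm (?F t))\<^sup>2)) \<partial>lborel)"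
    by (intro nn_integral_cong) (auto simp: indicator_def)
  also have "\<dots> = ennreal (freq_form N x)"
    using * by (subst nn_integral_eq_integral) (auto simp: has_bochner_integral_iff indicator_def)
  finally show ?thesis .
qed

section \<open>Exponential series on the half-line\<close>

text \<open>With \<open>x n = mart_dE M A (Suc (Suc n)) f\<close> at a point, this is minus the time
  derivative of the semigroup there; the term of frequency 0 has dropped out.\<close>

definition freq_series :: "(nat \<Rightarrow> complex) \<Rightarrow> real \<Rightarrow> complex" where
  "freq_series x t = (\<Sum>n. (freq (Suc n) * exp (- (t * freq (Suc n)))) *\<^sub>R x n)"

definition freq_summable :: "(nat \<Rightarrow> complex) \<Rightarrow> bool" where
  "freq_summable x \<longleftrightarrow> (\<forall>t>0. summable (\<lambda>n. freq (Suc n) * exp (- (t * freq (Suc n))) * norm (x n)))"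

lemma freq_form_le: "freq_form N x \<le> 23/60 * (\<Sum>n<N. (norm (x n))\<^sup>2)"
  and freq_form_ge: "7/60 * (\<Sum>n<N. (norm (x n))\<^sup>2) \<le> freq_form N x"
  using freq_form_bounds[of N x, THEN abs_le_D1] freq_form_bounds[of N x, THEN abs_le_D2]
  by (simp_all add: algebra_simps)

lemma freq_series_LIMSEQ:
  assumes "freq_summable x" "0 < t"
  shows "(\<lambda>N. \<Sum>n<N. (freq (Suc n) * exp (- (t * freq (Suc n)))) *\<^sub>R x n) \<longlonglongrightarrow> freq_series x t"
proof -
  have "summable (\<lambda>n. freq (Suc n) * exp (- (t * freq (Suc n))) * norm (x n))"
    using assms unfolding freq_summable_def by blast
  then have "summable (\<lambda>n. norm ((freq (Suc n) * exp (- (t * freq (Suc n)))) *\<^sub>R x n))"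
    by (simp add: abs_mult)
  then show ?thesis
    unfolding freq_series_def by (rule summable_LIMSEQ[OF summable_norm_cancel])
qed

lemma freq_series_measurable [measurable]: "freq_series x \<in> borel_measurable borel"
  unfolding freq_series_def[abs_def] by measurable

lemma nn_integral_freq_series_le:
  assumes x: "freq_summable x"
  shows "(\<integral>\<^sup>+t\<in>{0<..}. ennreal (t * (norm (freq_series x t))\<^sup>2) \<partial>lborel)
    \<le> ennreal (23/60) * (\<Sum>n. ennreal ((norm (x n))\<^sup>2))"
proof -
  let ?S = "\<lambda>N t. \<Sum>n<N. (freq (Suc n) * exp (- (t * freq (Suc n)))) *\<^sub>R x n"
  have "(\<integral>\<^sup>+t\<in>{0<..}. ennreal (t * (norm (freq_series x t))\<^sup>2) \<partial>lborel)
      = (\<integral>\<^sup>+t. liminf (\<lambda>N. ennreal (t * (norm (?S N t))\<^sup>2) * indicator {0<..} t) \<partial>lborel)"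
  proof (intro nn_integral_cong)
    fix t :: real
    show "ennreal (t * (norm (freq_series x t))\<^sup>2) * indicator {0<..} t
      = liminf (\<lambda>N. ennreal (t * (norm (?S N t))\<^sup>2) * indicator {0<..} t)"
    proof (cases "0 < t")
      case True
      then have "(\<lambda>N. ennreal (t * (norm (?S N t))\<^sup>2)) \<longlonglongrightarrow> ennreal (t * (norm (freq_series x t))\<^sup>2)"
        by (intro tendsto_intros freq_series_LIMSEQ x)
      from lim_imp_Liminf[OF _ this] show ?thesis using True by simp
    qed (simp add: Liminf_const)
  qed
  also have "\<dots> \<le> liminf (\<lambda>N. \<integral>\<^sup>+t\<in>{0<..}. ennreal (t * (norm (?S N t))\<^sup>2) \<partial>lborel)"
    by (intro nn_integral_liminf) measurable
  also have "\<dots> \<le> ennreal (23/60) * (\<Sum>n. ennreal ((norm (x n))\<^sup>2))"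
    unfolding nn_integral_exp_sum
  proof (rule Liminf_le)
    show "\<forall>\<^sub>F N in sequentially. ennreal (freq_form N x) \<le> ennreal (23/60) * (\<Sum>n. ennreal ((norm (x n))\<^sup>2))"
    proof (intro always_eventually allI)
      fix N
      have "ennreal (freq_form N x) \<le> ennreal (23/60 * (\<Sum>n<N. (norm (x n))\<^sup>2))"
        by (intro ennreal_leI freq_form_le)
      also have "\<dots> = ennreal (23/60) * (\<Sum>n<N. ennreal ((norm (x n))\<^sup>2))"
        by (subst ennreal_mult) (auto intro: sum_nonneg)
      also have "\<dots> \<le> ennreal (23/60) * (\<Sum>n. ennreal ((norm (x n))\<^sup>2))"
        by (intro mult_left_mono sum_le_suminf) auto
      finally show "ennreal (freq_form N x) \<le> ennreal (23/60) * (\<Sum>n. ennreal ((norm (x n))\<^sup>2))" .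
    qed
  qed simp
  finally show ?thesis .
qed

text \<open>The weight \<open>t\<close> is at most \<open>s + t\<close>, and after translation the
  integral runs only over the part of the half-line beyond \<open>s\<close>.\<close>

lemma nn_integral_freq_series_shift:
  assumes s: "0 < s"
  shows "(\<integral>\<^sup>+t\<in>{0<..}. ennreal (t * (norm (freq_series x (s + t)))\<^sup>2) \<partial>lborel)
    \<le> (\<integral>\<^sup>+t\<in>{0<..}. ennreal (t * (norm (freq_series x t))\<^sup>2) \<partial>lborel)"
proof -
  have "(\<integral>\<^sup>+t\<in>{0<..}. ennreal (t * (norm (freq_series x (s + t)))\<^sup>2) \<partial>lborel)
    \<le> (\<integral>\<^sup>+t. ennreal ((s + t) * (norm (freq_series x (s + t)))\<^sup>2) * indicator {0<..} (s + t) \<partial>lborel)"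
    using s by (intro nn_integral_mono) (auto simp: indicator_def intro!: ennreal_leI mult_right_mono)
  also have "\<dots> = (\<integral>\<^sup>+t\<in>{0<..}. ennreal (t * (norm (freq_series x t))\<^sup>2) \<partial>lborel)"
    using nn_integral_real_affine[of "\<lambda>t. ennreal (t * (norm (freq_series x t))\<^sup>2) * indicator {0<..} t" 1 s]
    by simp
  finally show ?thesis .
qed

text \<open>Damping makes all partial sums at \<open>t\<close> at most \<open>exp (- t) * C\<close>,
  uniformly in \<open>N\<close>, so \<open>C\<^sup>2 * t * exp (- 2 * t)\<close> dominates the
  integrands.\<close>

lemma freq_form_damped_LIMSEQ:
  assumes x: "freq_summable x" and s: "0 < s"
  shows "(\<lambda>N. ennreal (freq_form N (\<lambda>n. exp (- (s * freq (Suc n))) *\<^sub>R x n)))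
    \<longlonglongrightarrow> (\<integral>\<^sup>+t\<in>{0<..}. ennreal (t * (norm (freq_series x (s + t)))\<^sup>2) \<partial>lborel)"
proof -
  let ?y = "\<lambda>n. exp (- (s * freq (Suc n))) *\<^sub>R x n"
  let ?S = "\<lambda>N t. \<Sum>n<N. (freq (Suc n) * exp (- (t * freq (Suc n)))) *\<^sub>R ?y n"
  have S: "?S N t = (\<Sum>n<N. (freq (Suc n) * exp (- ((s + t) * freq (Suc n)))) *\<^sub>R x n)" for N t
    by (simp add: distrib_right exp_add exp_diff exp_minus inverse_eq_divide mult_ac)
  \<comment> \<open>Absolute convergence at the single time \<open>s > 0\<close> supplies the
    uniform constant.\<close>
  define C where "C = (\<Sum>n. freq (Suc n) * exp (- (s * freq (Suc n))) * norm (x n))"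
  have sm: "summable (\<lambda>n. freq (Suc n) * exp (- (s * freq (Suc n))) * norm (x n))"
    using x s by (simp add: freq_summable_def)
  have bd: "norm (?S N t) \<le> exp (- t) * C" if "0 < t" for N t
  proof -
    have "norm (?S N t) \<le> (\<Sum>n<N. exp (- t) * (freq (Suc n) * exp (- (s * freq (Suc n))) * norm (x n)))"
    proof (intro sum_norm_le)
      fix n
      have "1 \<le> freq (Suc n)" using freq_ge[of "Suc n"] by simp
      then have "exp (- (t * freq (Suc n))) \<le> exp (- t)" using that by simp
      from mult_right_mono[OF this, of "freq (Suc n) * exp (- (s * freq (Suc n))) * norm (x n)"]
      show "norm ((freq (Suc n) * exp (- (t * freq (Suc n)))) *\<^sub>R ?y n)
        \<le> exp (- t) * (freq (Suc n) * exp (- (s * freq (Suc n))) * norm (x n))"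
        by (simp add: mult_ac)
    qed
    also have "\<dots> \<le> exp (- t) * C"
      unfolding C_def sum_distrib_left[symmetric]
      by (intro mult_left_mono sum_le_suminf sm) auto
    finally show ?thesis .
  qed
  have "(\<lambda>N. \<integral>\<^sup>+t. ennreal (t * (norm (?S N t))\<^sup>2) * indicator {0<..} t \<partial>lborel)
    \<longlonglongrightarrow> (\<integral>\<^sup>+t. ennreal (t * (norm (freq_series x (s + t)))\<^sup>2) * indicator {0<..} t \<partial>lborel)"
  proof (rule nn_integral_dominated_convergence)
    show "AE t in lborel. ennreal (t * (norm (?S N t))\<^sup>2) * indicator {0<..} t
        \<le> ennreal (C\<^sup>2) * ennreal (indicator {0<..} t * (t * exp (- (t * 2))))" for N
    proof (intro always_eventually allI)
      fix t :: real
      show "ennreal (t * (norm (?S N t))\<^sup>2) * indicator {0<..} t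
        \<le> ennreal (C\<^sup>2) * ennreal (indicator {0<..} t * (t * exp (- (t * 2))))"
      proof (cases "0 < t")
        case True
        have "t * (norm (?S N t))\<^sup>2 \<le> t * (exp (- t) * C)\<^sup>2"
          using True bd by (intro mult_left_mono power_mono) auto
        also have "\<dots> = C\<^sup>2 * (t * exp (- (t * 2)))"
        proof -
          have "(exp (- t))\<^sup>2 = exp (- (t * 2))"
            by (subst exp_double[symmetric]) (simp add: mult.commute)
          then show ?thesis by (simp add: power_mult_distrib)
        qed
        finally show ?thesis using True by (simp add: ennreal_leI flip: ennreal_mult)
      qed simp
    qed
    have "(\<integral>\<^sup>+t. ennreal (indicator {0<..} t * (t * exp (- (t * 2)))) \<partial>lborel) < \<infinity>"
      using has_bochner_integral_t_exp[of 2]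
      by (subst nn_integral_eq_integral) (auto simp: has_bochner_integral_iff indicator_def)
    then show "(\<integral>\<^sup>+t. ennreal (C\<^sup>2) * ennreal (indicator {0<..} t * (t * exp (- (t * 2)))) \<partial>lborel) < \<infinity>"
      by (subst nn_integral_cmult) (auto simp: ennreal_mult_less_top)
    show "AE t in lborel. (\<lambda>N. ennreal (t * (norm (?S N t))\<^sup>2) * indicator {0<..} t)
        \<longlonglongrightarrow> ennreal (t * (norm (freq_series x (s + t)))\<^sup>2) * indicator {0<..} t"
    proof (intro always_eventually allI)
      fix t :: real
      show "(\<lambda>N. ennreal (t * (norm (?S N t))\<^sup>2) * indicator {0<..} t)
        \<longlonglongrightarrow> ennreal (t * (norm (freq_series x (s + t)))\<^sup>2) * indicator {0<..} t"
      proof (cases "0 < t")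
        case True
        then have "(\<lambda>N. ennreal (t * (norm (?S N t))\<^sup>2)) \<longlonglongrightarrow> ennreal (t * (norm (freq_series x (s + t)))\<^sup>2)"
          unfolding S using s by (intro tendsto_intros freq_series_LIMSEQ x) simp
        then show ?thesis using True by simp
      qed simp
    qed
  qed measurable
  then show ?thesis by (simp only: nn_integral_exp_sum)
qed

lemma nn_integral_freq_series_ge:
  assumes x: "freq_summable x"
  shows "ennreal (7/60) * (\<Sum>n. ennreal ((norm (x n))\<^sup>2))
    \<le> (\<integral>\<^sup>+t\<in>{0<..}. ennreal (t * (norm (freq_series x t))\<^sup>2) \<partial>lborel)" (is "_ \<le> ?I")
proof -
  \<comment> \<open>Fixing the cutoff \<open>k\<close> before letting \<open>N\<close> tend to
    infinity leaves a finite sum, in which \<open>s\<close> can tend to 0 termwise; \<open>k\<close>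
    grows last. Infinite total sums are thereby covered.\<close>
  have damped: "ennreal (7/60 * (\<Sum>n<k. (exp (- (s * freq (Suc n))) * norm (x n))\<^sup>2)) \<le> ?I"
    if s: "0 < s" for k s
  proof -
    let ?y = "\<lambda>n. exp (- (s * freq (Suc n))) *\<^sub>R x n"
    have "ennreal (7/60 * (\<Sum>n<k. (norm (?y n))\<^sup>2))
      \<le> (\<integral>\<^sup>+t\<in>{0<..}. ennreal (t * (norm (freq_series x (s + t)))\<^sup>2) \<partial>lborel)"
    proof (rule LIMSEQ_le_const[OF freq_form_damped_LIMSEQ[OF x s]], intro exI allI impI)
      fix N assume "k \<le> N"
      then have "(\<Sum>n<k. (norm (?y n))\<^sup>2) \<le> (\<Sum>n<N. (norm (?y n))\<^sup>2)"
        by (intro sum_mono2) auto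
      then show "ennreal (7/60 * (\<Sum>n<k. (norm (?y n))\<^sup>2)) \<le> ennreal (freq_form N ?y)"
        using freq_form_ge[of ?y N] by (intro ennreal_leI) linarith
    qed
    also have "\<dots> \<le> ?I" by (rule nn_integral_freq_series_shift[OF s])
    finally show ?thesis by simp
  qed
  have "ennreal (7/60) * (\<Sum>n<k. ennreal ((norm (x n))\<^sup>2)) \<le> ?I" for k
  proof -
    have "(\<lambda>j. ennreal (7/60 * (\<Sum>n<k. (exp (- (inverse (real (Suc j)) * freq (Suc n))) * norm (x n))\<^sup>2)))
      \<longlonglongrightarrow> ennreal (7/60 * (\<Sum>n<k. (exp (- (0 * freq (Suc n))) * norm (x n))\<^sup>2))"
      by (intro tendsto_ennrealI tendsto_mult_left tendsto_sum tendsto_power tendsto_mult_right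
        tendsto_exp tendsto_minus LIMSEQ_inverse_real_of_nat)
    then have "ennreal (7/60 * (\<Sum>n<k. (exp (- (0 * freq (Suc n))) * norm (x n))\<^sup>2)) \<le> ?I"
      by (rule LIMSEQ_le_const2) (use damped in auto)
    also have "7/60 * (\<Sum>n<k. (exp (- (0 * freq (Suc n))) * norm (x n))\<^sup>2) = 7/60 * (\<Sum>n<k. (norm (x n))\<^sup>2)"
      by simp
    also have "ennreal \<dots> = ennreal (7/60) * (\<Sum>n<k. ennreal ((norm (x n))\<^sup>2))"
      by (subst ennreal_mult) (auto intro: sum_nonneg)
    finally show ?thesis .
  qed
  then have "(\<Sum>n. ennreal (7/60) * ennreal ((norm (x n))\<^sup>2)) \<le> ?I"
    by (intro suminf_le_const) (auto simp del: sum_ennreal simp flip: sum_distrib_left)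
  then show ?thesis by simp
qed

section \<open>Convergence and differentiation of exponential series\<close>

text \<open>The excess \<open>t - s\<close> is split into two halves \<open>\<delta>\<close>: one
  absorbs the factor \<open>L n\<close> through \<open>y * exp (- y) \<le> 1\<close>, the other
  gives geometric decay, and the remaining \<open>exp (- (s * L n))\<close> is used up by the bound
  \<open>K\<close>.\<close>

lemma exp_series_summable:
  fixes L :: "nat \<Rightarrow> real" and d :: "nat \<Rightarrow> complex"
  assumes L: "\<And>n. real n \<le> L n" and bd: "\<And>n. exp (- (s * L n)) * norm (d n) \<le> K" and st: "s < t"
  shows "summable (\<lambda>n. L n * exp (- (t * L n)) * norm (d n))" (is ?A)
    and "summable (\<lambda>n. exp (- (t * L n)) * norm (d n))" (is ?B)
proof -
  define \<delta> where "\<delta> = (t - s) / 2"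
  have \<delta>: "0 < \<delta>" using st by (simp add: \<delta>_def)
  have L0: "0 \<le> L n" for n using L[of n] by linarith
  have t: "t * L n = \<delta> * L n + (\<delta> * L n + s * L n)" for n
    by (simp add: \<delta>_def field_simps)
  have K: "0 \<le> K" using bd[of 0] by (meson exp_ge_zero mult_nonneg_nonneg norm_ge_zero order_trans)
  have dec: "exp (- (\<delta> * L n)) \<le> exp (- \<delta>) ^ n" for n
    using L[of n] \<delta> by (simp flip: exp_of_nat_mult)
  have rest: "exp (- (\<delta> * L n)) * (exp (- (s * L n)) * norm (d n)) \<le> exp (- \<delta>) ^ n * K" for n
    using dec bd K by (intro mult_mono) auto
  have sm: "summable (\<lambda>n. c * (exp (- \<delta>) ^ n * K))" for c
    using \<delta> by (intro summable_mult summable_mult2 summable_geometric) auto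
  show ?A
  proof (rule summable_comparison_test'[OF sm[of "1 / \<delta>"]])
    fix n
    have "\<delta> * L n * exp (- (\<delta> * L n)) \<le> exp (\<delta> * L n) * exp (- (\<delta> * L n))"
      by (intro mult_right_mono[OF order_trans[OF _ exp_ge_add_one_self]]) auto
    also have "\<dots> = 1" by (simp flip: exp_add)
    finally have "L n * exp (- (\<delta> * L n)) \<le> 1 / \<delta>"
      using \<delta> by (simp add: field_simps)
    then have "(L n * exp (- (\<delta> * L n))) * (exp (- (\<delta> * L n)) * (exp (- (s * L n)) * norm (d n)))
        \<le> 1 / \<delta> * (exp (- \<delta>) ^ n * K)"
      using \<delta> by (intro mult_mono[OF _ rest]) auto
    then show "norm (L n * exp (- (t * L n)) * norm (d n)) \<le> 1 / \<delta> * (exp (- \<delta>) ^ n * K)"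
      unfolding t minus_add_distrib exp_add using L0[of n] by (simp add: abs_mult mult_ac)
  qed
  show ?B
  proof (rule summable_comparison_test'[OF sm[of 1]])
    fix n
    have "exp (- (\<delta> * L n)) \<le> 1" using \<delta> L0[of n] by simp
    then have "exp (- (\<delta> * L n)) * (exp (- (\<delta> * L n)) * (exp (- (s * L n)) * norm (d n)))
        \<le> 1 * (exp (- \<delta>) ^ n * K)"
      by (intro mult_mono[OF _ rest]) auto
    then show "norm (exp (- (t * L n)) * norm (d n)) \<le> 1 * (exp (- \<delta>) ^ n * K)"
      unfolding t minus_add_distrib exp_add by (simp add: abs_mult mult_ac)
  qed
qed

text \<open>Termwise differentiation of series is a statement about functions of a field variable
  with values in the same field, so the series is extended to a complex half-plane and then
  restricted to the real line.\<close>

lemma exp_series_has_vector_derivative: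
  fixes L :: "nat \<Rightarrow> real" and d :: "nat \<Rightarrow> complex"
  assumes L: "\<And>n. real n \<le> L n" and bd: "\<And>n. exp (- (s * L n)) * norm (d n) \<le> K" and st: "s < t"
  shows "((\<lambda>r. \<Sum>n. exp (- (r * L n)) *\<^sub>R d n) has_vector_derivative
    - (\<Sum>n. (L n * exp (- (t * L n))) *\<^sub>R d n)) (at t)"
proof -
  \<comment> \<open>Between \<open>s\<close> and \<open>t\<close>: the derived series converges
    absolutely at \<open>u\<close> and is the Weierstrass majorant on the open half-plane
    \<open>Re z > u\<close>, which contains \<open>t\<close>.\<close>
  define u where "u = (s + t) / 2"
  have u: "s < u" "u < t" using st by (auto simp: u_def)
  have L0: "0 \<le> L n" for n using L[of n] by linarith
  define f where "f n z = exp (- (z * of_real (L n))) * d n" for n and z :: complex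
  define f' where "f' n z = - (of_real (L n) * exp (- (z * of_real (L n))) * d n)" for n and z :: complex
  have f_real: "f n (of_real r) = exp (- (r * L n)) *\<^sub>R d n" for n r
    by (simp add: f_def scaleR_conv_of_real flip: exp_of_real)
  have f'_real: "f' n (of_real r) = - ((L n * exp (- (r * L n))) *\<^sub>R d n)" for n r
    by (simp add: f'_def scaleR_conv_of_real flip: exp_of_real)
  have "((\<lambda>z. \<Sum>n. f n z) has_field_derivative (\<Sum>n. f' n (of_real t))) (at (of_real t))"
  proof (rule has_field_derivative_series')
    show "convex {z. u < Re z}" by (rule convex_halfspace_Re_gt)
    show "(f n has_field_derivative f' n z) (at z within {z. u < Re z})" for n z
      unfolding f_def f'_def by (auto intro!: derivative_eq_intros)
    show "uniformly_convergent_on {z. u < Re z} (\<lambda>n z. \<Sum>i<n. f' i z)"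
    proof (rule Weierstrass_m_test')
      show "summable (\<lambda>n. L n * exp (- (u * L n)) * norm (d n))"
        by (rule exp_series_summable(1)[OF L bd u(1)])
      show "norm (f' n z) \<le> L n * exp (- (u * L n)) * norm (d n)" if "z \<in> {z. u < Re z}" for n z
        using that L0[of n]
        by (auto simp: f'_def norm_mult intro!: mult_right_mono mult_left_mono)
    qed
    show "complex_of_real t \<in> {z. u < Re z}" using u by simp
    have "{z. u < Re z} = interior {z. u < Re z}"
      by (simp add: interior_open open_halfspace_Re_gt)
    then show "complex_of_real t \<in> interior {z. u < Re z}" using u by auto
    show "summable (\<lambda>n. f n (complex_of_real t))"
      unfolding f_real
      by (rule summable_norm_cancel) (use exp_series_summable(2)[OF L bd st] in simp)
  qed
  from has_vector_derivative_real_field[OF this, of UNIV]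
  have "((\<lambda>r. \<Sum>n. exp (- (r * L n)) *\<^sub>R d n) has_vector_derivative
    (\<Sum>n. - ((L n * exp (- (t * L n))) *\<^sub>R d n))) (at t)"
    unfolding f_real f'_real .
  moreover have "summable (\<lambda>n. (L n * exp (- (t * L n))) *\<^sub>R d n)"
    using exp_series_summable(1)[OF L bd st] L0
    by (intro summable_norm_cancel[of "\<lambda>n. (L n * exp (- (t * L n))) *\<^sub>R d n"]) (simp add: abs_mult)
  ultimately show ?thesis by (simp add: suminf_minus)
qed

text \<open>As for Dirichlet series, convergence at \<open>s\<close> bounds the terms there, and
  bounded terms at \<open>s\<close> force absolute convergence at every later
  \<open>t\<close>.\<close>

lemma exp_series_summable_mono:
  fixes L :: "nat \<Rightarrow> real" and d :: "nat \<Rightarrow> complex"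
  assumes L: "\<And>n. real n \<le> L n" and sm: "summable (\<lambda>n. exp (- (s * L n)) *\<^sub>R d n)" and st: "s < t"
  obtains K where "\<And>n. exp (- (s * L n)) * norm (d n) \<le> K" "summable (\<lambda>n. exp (- (t * L n)) *\<^sub>R d n)"
proof -
  obtain K where "\<And>n. norm (exp (- (s * L n)) *\<^sub>R d n) \<le> K"
    using summable_imp_Bseq[OF sm] by (auto simp: Bseq_def)
  then have K: "exp (- (s * L n)) * norm (d n) \<le> K" for n by simp
  show thesis
  proof (rule that[OF K])
    show "summable (\<lambda>n. exp (- (t * L n)) *\<^sub>R d n)"
      by (rule summable_norm_cancel) (use exp_series_summable(2)[OF L K st] in simp)
  qed
qed

text \<open>Left of the abscissa of convergence \<open>suminf\<close> takes the constant junk value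
  \<open>THE x. False\<close>, so its derivative vanishes there; only the abscissa itself escapes.\<close>

lemma vector_derivative_exp_series:
  fixes L :: "nat \<Rightarrow> real" and d :: "nat \<Rightarrow> complex"
  assumes L: "\<And>n. real n \<le> L n"
  obtains b where "\<And>t. t \<noteq> b \<Longrightarrow> vector_derivative (\<lambda>r. \<Sum>n. exp (- (r * L n)) *\<^sub>R d n) (at t) =
     (if summable (\<lambda>n. exp (- (t * L n)) *\<^sub>R d n) then - (\<Sum>n. (L n * exp (- (t * L n))) *\<^sub>R d n) else 0)"
proof -
  let ?C = "\<lambda>t. summable (\<lambda>n. exp (- (t * L n)) *\<^sub>R d n)"
  let ?F = "\<lambda>r. \<Sum>n. exp (- (r * L n)) *\<^sub>R d n"
  define P where "P t \<longleftrightarrow> vector_derivative ?F (at t) =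
     (if ?C t then - (\<Sum>n. (L n * exp (- (t * L n))) *\<^sub>R d n) else 0)" for t
  have right: "P t" if "?C r" "r < t" for r t
    using exp_series_summable_mono[OF L that]
    by (metis (no_types, lifting) P_def exp_series_has_vector_derivative[OF L _ that(2)] vector_derivative_at)
  have left: "P t" if "\<not> ?C r" "t < r" for r t
  proof -
    have nC: "\<not> ?C t'" if "t' \<in> {..<r}" for t'
      using exp_series_summable_mono[OF L, of t' d r] \<open>\<not> ?C r\<close> that by auto
    have "(?F has_vector_derivative 0) (at t)"
    proof (rule has_vector_derivative_transform_within_open[of "\<lambda>_. THE x. False"])
      show "(THE x. False) = ?F t'" if "t' \<in> {..<r}" for t'
        using nC[OF that] by (simp add: suminf_def summable_def)
    qed (use that in auto)
    then show ?thesis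
      using nC[of t] that by (simp add: P_def vector_derivative_at)
  qed
  \<comment> \<open>Two exceptional times cannot exist: if the series converges at their midpoint,
    the later one satisfies \<open>P\<close>, otherwise the earlier one does.\<close>
  have "\<exists>b. \<forall>t. t \<noteq> b \<longrightarrow> P t"
  proof (rule ccontr)
    assume "\<not> ?thesis"
    then obtain t1 t2 where "\<not> P t1" "\<not> P t2" "t1 < t2" by (metis linorder_neqE_linordered_idom)
    then show False
      using right[of "(t1 + t2) / 2" t2] left[of "(t1 + t2) / 2" t1] by auto
  qed
  then show thesis using that unfolding P_def by blast
qed

section \<open>The pointwise bounds\<close>

lemma epowr_mono: "x \<le> y \<Longrightarrow> 0 \<le> r \<Longrightarrow> epowr x r \<le> epowr y r"
  by (auto simp: epowr_def top_unique less_top intro!: ennreal_leI powr_mono2 enn2real_mono)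

lemma epowr_cmult:
  assumes "0 < c"
  shows "epowr (ennreal c * z) r = ennreal (c powr r) * epowr z r"
  using assms by (cases z) (auto simp: epowr_def ennreal_mult_top powr_mult simp flip: ennreal_mult)

lemma epowr_measurable [measurable (raw)]:
  assumes [measurable]: "g \<in> borel_measurable M"
  shows "(\<lambda>x. epowr (g x) r) \<in> borel_measurable M"
  unfolding epowr_def by measurable

lemma semigroup_T_eq:
  "semigroup_T M A t f x = (\<Sum>n. exp (- (t * freq n)) *\<^sub>R mart_dE M A (Suc n) f x)"
  by (simp add: semigroup_T_def powr_freq)

section \<open>Measurability of the square function and the g-function\<close>

lemma mart_dE_measurable [measurable]:
  assumes "prob_space M" "generating_filtration M A"
  shows "mart_dE M A n f \<in> borel_measurable M"
  using mart_E_measurable[OF assms] unfolding mart_dE_def[abs_def] by measurable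

lemma square_fun_measurable:
  assumes "prob_space M" "generating_filtration M A"
  shows "square_fun M A f \<in> borel_measurable M"
  using mart_dE_measurable[OF assms, measurable] unfolding square_fun_def[abs_def] by measurable

text \<open>Measurability up to null sets would not do for \<open>p = \<infinity>\<close>: \<open>esssup\<close> is \<open>\<top>\<close> on every
  non-measurable function.\<close>

lemma G_fun_measurable:
  assumes "prob_space M" "generating_filtration M A"
  shows "G_fun M A f \<in> borel_measurable M"
proof -
  note [measurable] = mart_dE_measurable[OF assms]
  let ?d = "\<lambda>x n. mart_dE M A (Suc n) f x"
  \<comment> \<open>A jointly measurable substitute for the derivative, which for each
    \<open>x\<close> differs from it at no more than one time \<open>b\<close>, hence on a null set
    of times.\<close>
  define h where "h x t = (if summable (\<lambda>n. exp (- (t * freq n)) *\<^sub>R ?d x n)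
      then - (\<Sum>n. (freq n * exp (- (t * freq n))) *\<^sub>R ?d x n) else 0)" for x t
  have [measurable]: "case_prod h \<in> borel_measurable (M \<Otimes>\<^sub>M lborel)"
    \<comment> \<open>Summability becomes the Cauchy property of the partial sums, which mentions no
      unknown limit.\<close>
    unfolding h_def[abs_def] summable_iff_convergent Cauchy_convergent_iff[symmetric] case_prod_beta
    by measurable
  have "G_fun M A f x = epowr (\<integral>\<^sup>+t. ennreal ((norm (t *\<^sub>R h x t))\<^sup>2 / t) * indicator {0<..} t \<partial>lborel) (1/2)" for x
  proof -
    obtain b where b: "\<And>t. t \<noteq> b \<Longrightarrow> vector_derivative (\<lambda>r. semigroup_T M A r f x) (at t) = h x t"
      unfolding semigroup_T_eq h_def
      using vector_derivative_exp_series[of freq "?d x", OF freq_ge] by blast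
    have "AE t in lborel. t \<noteq> b" by (rule AE_lborel_singleton)
    then show ?thesis
      unfolding G_fun_def
      by (intro arg_cong2[where f=epowr] nn_integral_cong_AE) (auto elim!: eventually_mono simp: b)
  qed
  then have "G_fun M A f = (\<lambda>x. epowr (\<integral>\<^sup>+t. ennreal ((norm (t *\<^sub>R h x t))\<^sup>2 / t) * indicator {0<..} t \<partial>lborel) (1/2))"
    by (rule ext)
  also have "\<dots> \<in> borel_measurable M" by measurable
  finally show ?thesis .
qed

text \<open>Almost every point satisfies this growth bound, and it is all that the pointwise
  argument needs: \<open>freq\<close> grows so fast that every series involved then converges
  for all \<open>t > 0\<close>.\<close>

lemma AE_mart_dE_growth:
  assumes "prob_space M" "generating_filtration M A" and f: "integrable M f"
  shows "AE x in M. \<exists>C. \<forall>n. norm (mart_dE M A (Suc n) f x) \<le> C * 2 ^ n"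
proof -
  note [measurable] = mart_dE_measurable[OF assms(1,2)]
  define I where "I = (\<integral>\<^sup>+x. ennreal (norm (f x)) \<partial>M)"
  have I: "I < \<top>" using f by (simp add: I_def integrable_iff_bounded)
  \<comment> \<open>The differences have L1 norms at most \<open>4 * I\<close>, so the weights
    \<open>(1/2) ^ n\<close> make the series integrable and hence finite almost everywhere; each
    term is then bounded by the sum.\<close>
  have "(\<integral>\<^sup>+x. (\<Sum>n. ennreal ((1/2) ^ n * norm (mart_dE M A (Suc n) f x))) \<partial>M)
     = (\<Sum>n. \<integral>\<^sup>+x. ennreal ((1/2) ^ n * norm (mart_dE M A (Suc n) f x)) \<partial>M)"
    by (intro nn_integral_suminf) auto
  also have "\<dots> = (\<Sum>n. ennreal ((1/2) ^ n) * (\<integral>\<^sup>+x. ennreal (norm (mart_dE M A (Suc n) f x)) \<partial>M))"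
    by (subst nn_integral_cmult[symmetric]) (auto simp: ennreal_mult)
  also have "\<dots> \<le> (\<Sum>n. ennreal ((1/2) ^ n) * (4 * I))"
    unfolding I_def by (intro suminf_le mult_left_mono mart_dE_L1[OF assms]) auto
  also have "\<dots> = ennreal (\<Sum>n. (1/2) ^ n) * (4 * I)"
    by (subst ennreal_suminf_multc, subst suminf_ennreal2) (auto intro!: summable_geometric)
  also have "\<dots> < \<top>" using I by (simp add: ennreal_mult_less_top)
  finally have "AE x in M. (\<Sum>n. ennreal ((1/2) ^ n * norm (mart_dE M A (Suc n) f x))) \<noteq> \<infinity>"
    by (intro nn_integral_noteq_infinite) auto
  then show ?thesis
  proof eventually_elim
    case (elim x)
    let ?g = "\<lambda>n. (1/2) ^ n * norm (mart_dE M A (Suc n) f x)"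
    have sm: "summable ?g" using elim by (intro summable_suminf_not_top) auto
    have "norm (mart_dE M A (Suc n) f x) \<le> suminf ?g * 2 ^ n" for n
      using sum_le_suminf[OF sm, of "{n}"] by (simp add: field_simps)
    then show ?case by blast
  qed
qed

section \<open>Pointwise consequences of the growth bound\<close>

text \<open>The summand 1 takes care of \<open>n = 0\<close>, where \<open>freq\<close>
  vanishes.\<close>

lemma two_power_le_freq: "2 ^ n \<le> 1 + freq n"
proof -
  have "(2 :: real) ^ n \<le> 16 ^ n" by (intro power_mono) auto
  also have "\<dots> \<le> 16 ^ (n + 1)" by simp
  finally show ?thesis by (auto simp: freq_def)
qed

text \<open>Turns the growth bound into the boundedness hypothesis of the exponential series lemmas,
  again by \<open>y * exp (- y) \<le> 1\<close>, now with \<open>y = s * freq n\<close>.\<close>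

lemma growth_damped_bounded:
  fixes d :: "nat \<Rightarrow> complex"
  assumes d: "\<And>n. norm (d n) \<le> C * 2 ^ n" and s: "0 < s"
  shows "exp (- (s * freq n)) * norm (d n) \<le> (1 + 1 / s) * C"
proof -
  have C: "0 \<le> C" using order_trans[OF norm_ge_zero d[of 0]] by simp
  have "s * freq n * exp (- (s * freq n)) \<le> exp (s * freq n) * exp (- (s * freq n))"
    by (intro mult_right_mono[OF order_trans[OF _ exp_ge_add_one_self]]) auto
  then have 1: "freq n * exp (- (s * freq n)) \<le> 1 / s"
    using s by (simp add: field_simps flip: exp_add)
  have 2: "exp (- (s * freq n)) \<le> 1" using s by simp
  have "exp (- (s * freq n)) * norm (d n) \<le> exp (- (s * freq n)) * ((1 + freq n) * C)"
    using d[of n] mult_left_mono[OF two_power_le_freq[of n] C]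
    by (intro mult_left_mono) (auto simp: mult.commute)
  also have "\<dots> = (exp (- (s * freq n)) + freq n * exp (- (s * freq n))) * C"
    by (simp add: algebra_simps)
  also have "\<dots> \<le> (1 + 1 / s) * C"
    using 1 2 C by (intro mult_right_mono add_mono)
  finally show ?thesis .
qed

lemma growth_summable:
  fixes d :: "nat \<Rightarrow> complex"
  assumes d: "\<And>n. norm (d n) \<le> C * 2 ^ n" and t: "0 < t"
  shows "summable (\<lambda>n. freq n * exp (- (t * freq n)) * norm (d n))"
    and "summable (\<lambda>n. exp (- (t * freq n)) *\<^sub>R d n)"
proof -
  have s: "0 < t / 2" "t / 2 < t" using t by auto
  note bd = growth_damped_bounded[OF d s(1)]
  show "summable (\<lambda>n. freq n * exp (- (t * freq n)) * norm (d n))"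
    by (rule exp_series_summable(1)[OF freq_ge bd s(2)])
  show "summable (\<lambda>n. exp (- (t * freq n)) *\<^sub>R d n)"
    by (rule summable_norm_cancel) (use exp_series_summable(2)[OF freq_ge bd s(2)] in simp)
qed

text \<open>The second series arises from the first by summation by parts, once the boundary term
  \<open>?c N *\<^sub>R ?E N\<close> is known to vanish in the limit.\<close>

lemma semigroup_T_sums:
  assumes d: "\<And>n. norm (mart_dE M A (Suc n) f x) \<le> C * 2 ^ n" and t: "0 < t"
  shows "(\<lambda>n. ((1 - coeff_a n) powr t) *\<^sub>R mart_dE M A (Suc n) f x) sums semigroup_T M A t f x" (is ?A)
    and "(\<lambda>n. ((1 - coeff_a n) powr t - (1 - coeff_a (Suc n)) powr t) *\<^sub>R mart_E M A (Suc n) f x)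
      sums semigroup_T M A t f x" (is ?B)
proof -
  let ?d = "\<lambda>n. mart_dE M A (Suc n) f x" and ?E = "\<lambda>n. mart_E M A n f x"
  let ?c = "\<lambda>n. (1 - coeff_a n) powr t"
  show A: ?A
    unfolding semigroup_T_def powr_freq by (intro summable_sums growth_summable(2)[OF d t])
  \<comment> \<open>The growth bound passes from the differences to the \<open>E n\<close> with the
    same constant, since \<open>2 ^ n + 2 ^ n = 2 ^ Suc n\<close>. So
    \<open>?c n *\<^sub>R ?E n\<close> is summable and tends to 0.\<close>
  have E_le: "norm (?E n) \<le> C * 2 ^ n" for n
  proof (induction n)
    case (Suc n)
    have "?E (Suc n) = ?E n + ?d n" by (simp add: mart_dE_def)
    then have "norm (?E (Suc n)) \<le> norm (?E n) + norm (?d n)" by (simp add: norm_triangle_ineq)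
    then show ?case using Suc d[of n] by simp
  next
    case 0
    then show ?case using order_trans[OF norm_ge_zero d[of 0]] by (simp add: mart_E_def)
  qed
  have "(\<lambda>n. ?c n *\<^sub>R ?E n) \<longlonglongrightarrow> 0"
    unfolding powr_freq by (intro summable_LIMSEQ_zero growth_summable(2)[OF E_le t])
  then have "(\<lambda>N. (\<Sum>n<N. ?c n *\<^sub>R ?d n) - ?c N *\<^sub>R ?E N) \<longlonglongrightarrow> semigroup_T M A t f x - 0"
    using A unfolding sums_def by (intro tendsto_diff)
  moreover have "(\<Sum>n<N. (?c n - ?c (Suc n)) *\<^sub>R ?E (Suc n)) = (\<Sum>n<N. ?c n *\<^sub>R ?d n) - ?c N *\<^sub>R ?E N" for N
  proof (induction N)
    case (Suc N)
    then show ?case by (simp add: mart_dE_def algebra_simps)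
  qed (simp add: mart_E_def)
  ultimately show ?B unfolding sums_def by simp
qed

text \<open>The first difference has frequency 0 and is lost on differentiation, so \<open>S\<close>
  starts with the second one. The bounds on the integral then pass through the square root.\<close>

lemma G_fun_bounds:
  assumes d: "\<And>n. norm (mart_dE M A (Suc n) f x) \<le> C * 2 ^ n"
  defines "S \<equiv> epowr (\<Sum>n. ennreal ((norm (mart_dE M A (Suc (Suc n)) f x))\<^sup>2)) (1/2)"
  shows "ennreal (sqrt (7/60)) * S \<le> G_fun M A f x"
    and "G_fun M A f x \<le> ennreal (sqrt (23/60)) * S"
proof -
  let ?d = "\<lambda>n. mart_dE M A (Suc n) f x" and ?e = "\<lambda>n. mart_dE M A (Suc (Suc n)) f x"
  have e: "freq_summable ?e"
    unfolding freq_summable_def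
  proof (intro allI impI)
    fix t :: real assume "0 < t"
    from growth_summable(1)[OF d this]
    show "summable (\<lambda>n. freq (Suc n) * exp (- (t * freq (Suc n))) * norm (?e n))"
      by (rule summable_Suc_iff[THEN iffD2])
  qed
  have deriv: "vector_derivative (\<lambda>r. semigroup_T M A r f x) (at t) = - freq_series ?e t" if t: "0 < t" for t
  proof -
    have s: "0 < t / 2" "t / 2 < t" using t by auto
    have "summable (\<lambda>n. (freq n * exp (- (t * freq n))) *\<^sub>R ?d n)"
      by (rule summable_norm_cancel) (use growth_summable(1)[OF d t] in \<open>simp add: abs_mult\<close>)
    from suminf_split_head[OF this]
    have "(\<Sum>n. (freq n * exp (- (t * freq n))) *\<^sub>R ?d n) = freq_series ?e t"
      by (simp add: freq_series_def freq_def[of 0])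
    then show ?thesis
      unfolding semigroup_T_eq
      using exp_series_has_vector_derivative[OF freq_ge growth_damped_bounded[OF d s(1)] s(2)]
      by (simp add: vector_derivative_at)
  qed
  have G: "G_fun M A f x = epowr (\<integral>\<^sup>+t\<in>{0<..}. ennreal (t * (norm (freq_series ?e t))\<^sup>2) \<partial>lborel) (1/2)"
    unfolding G_fun_def
    by (intro arg_cong2[where f=epowr] nn_integral_cong)
       (auto simp: indicator_def deriv power_mult_distrib power2_eq_square)
  have sq: "epowr (ennreal c * z) (1/2) = ennreal (sqrt c) * epowr z (1/2)" if "0 < c" for c z
    using that by (simp add: epowr_cmult powr_half_sqrt)
  show "ennreal (sqrt (7/60)) * S \<le> G_fun M A f x"
    unfolding G S_def by (subst sq[symmetric]) (auto intro!: epowr_mono nn_integral_freq_series_ge[OF e])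
  show "G_fun M A f x \<le> ennreal (sqrt (23/60)) * S"
    unfolding G S_def by (subst sq[symmetric]) (auto intro!: epowr_mono nn_integral_freq_series_le[OF e])
qed

section \<open>Removing the fixed part\<close>

lemma mart_E_diff:
  assumes "prob_space M" "generating_filtration M A" "integrable M f" "integrable M g"
  shows "AE x in M. mart_E M A n (\<lambda>y. f y - g y) x = mart_E M A n f x - mart_E M A n g x"
proof (cases "n = 0")
  case False
  then interpret S: sigma_finite_subalgebra M "A n" using sigma_finite_A[OF assms(1,2)] by simp
  have "AE x in M. real_cond_exp M (A n) (\<lambda>y. Re (f y) - Re (g y)) x
        = real_cond_exp M (A n) (\<lambda>y. Re (f y)) x - real_cond_exp M (A n) (\<lambda>y. Re (g y)) x"
    "AE x in M. real_cond_exp M (A n) (\<lambda>y. Im (f y) - Im (g y)) x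
        = real_cond_exp M (A n) (\<lambda>y. Im (f y)) x - real_cond_exp M (A n) (\<lambda>y. Im (g y)) x"
    using assms by (intro S.real_cond_exp_diff; auto)+
  then show ?thesis
    by eventually_elim (use False in \<open>simp add: mart_E_def complex_cond_exp_def complex_eq_iff\<close>)
qed (simp add: mart_E_def)

text \<open>Subtracting the fixed part shifts every \<open>E n\<close> with \<open>n \<ge> 1\<close>
  by the same function, almost everywhere. The first difference becomes 0 because of the convention
  at index 0; the later ones are unchanged.\<close>

lemma square_fun_fix_proj:
  assumes MA: "prob_space M" "generating_filtration M A" and f: "integrable M f"
  shows "AE x in M. square_fun M A (\<lambda>y. f y - fix_proj M A f y) x
    = epowr (\<Sum>n. ennreal ((norm (mart_dE M A (Suc (Suc n)) f x))\<^sup>2)) (1/2)"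
proof -
  let ?g = "\<lambda>y. f y - fix_proj M A f y"
  have "AE x in M. \<forall>n. mart_E M A (Suc n) ?g x = mart_E M A (Suc n) f x - fix_proj M A f x"
    unfolding AE_all_countable
  proof
    fix n
    from mart_E_diff[OF MA f integrable_fix_proj[OF MA f], of "Suc n"] mart_E_fix_proj[OF MA f, of "Suc n"]
    show "AE x in M. mart_E M A (Suc n) ?g x = mart_E M A (Suc n) f x - fix_proj M A f x"
      by auto
  qed
  then show ?thesis
  proof eventually_elim
    case (elim x)
    have 0: "mart_dE M A (Suc 0) ?g x = 0"
      using elim[rule_format, of 0] by (simp add: mart_dE_def mart_E_def[of _ _ 0] fix_proj_def)
    have Suc: "mart_dE M A (Suc (Suc n)) ?g x = mart_dE M A (Suc (Suc n)) f x" for n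
      using elim by (simp add: mart_dE_def)
    have "(\<lambda>n. ennreal ((norm (mart_dE M A (Suc (Suc n)) ?g x))\<^sup>2)) sums
        (\<Sum>n. ennreal ((norm (mart_dE M A (Suc (Suc n)) ?g x))\<^sup>2))"
      by (intro summable_sums summableI)
    from sums_unique[OF sums_Suc[OF this]]
    have "(\<Sum>n. ennreal ((norm (mart_dE M A (Suc n) ?g x))\<^sup>2))
      = (\<Sum>n. ennreal ((norm (mart_dE M A (Suc (Suc n)) f x))\<^sup>2))"
      unfolding Suc 0 by simp
    then show ?case by (simp add: square_fun_def)
  qed
qed

section \<open>Norms\<close>

text \<open>On a probability space \<open>y \<le> 1 + y powr q\<close> gives integrability for
  finite exponents, and constants are integrable for \<open>p = \<top>\<close>.\<close>

lemma Lp_space_integrable: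
  assumes "prob_space M" and p: "1 \<le> p" and f: "f \<in> Lp_space M p"
  shows "integrable M f"
proof -
  interpret prob_space M by fact
  have [measurable]: "f \<in> borel_measurable M"
    and fin: "Lp_norm M p (\<lambda>x. ennreal (norm (f x))) < \<top>"
    using f by (auto simp: Lp_space_def)
  have "(\<integral>\<^sup>+x. ennreal (norm (f x)) \<partial>M) < \<top>"
  proof (cases "p = \<top>")
    case True
    let ?c = "esssup M (\<lambda>x. ennreal (norm (f x)))"
    have "(\<integral>\<^sup>+x. ennreal (norm (f x)) \<partial>M) \<le> (\<integral>\<^sup>+x. ?c \<partial>M)"
      by (intro nn_integral_mono_AE esssup_AE)
    then show ?thesis
      using fin True by (simp add: Lp_norm_def emeasure_space_1)
  next
    case False
    define q where "q = enn2real p"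
    have q: "1 \<le> q"
      using enn2real_mono[OF p] False by (simp add: q_def less_top)
    let ?I = "\<integral>\<^sup>+x. epowr (ennreal (norm (f x))) q \<partial>M"
    have I: "?I < \<top>"
      using fin False by (auto simp: Lp_norm_def q_def epowr_def less_top split: if_splits)
    have "(\<integral>\<^sup>+x. ennreal (norm (f x)) \<partial>M) \<le> (\<integral>\<^sup>+x. 1 + epowr (ennreal (norm (f x))) q \<partial>M)"
    proof (intro nn_integral_mono)
      fix x
      have "norm (f x) \<le> 1 + norm (f x) powr q"
      proof (cases "norm (f x) \<le> 1")
        case False
        then have "norm (f x) powr 1 \<le> norm (f x) powr q" using q by (intro powr_mono) auto
        then show ?thesis using False by simp
      next
        case True
        then show ?thesis using powr_ge_zero[of "norm (f x)" q] by linarith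
      qed
      from ennreal_leI[OF this]
      show "ennreal (norm (f x)) \<le> 1 + epowr (ennreal (norm (f x))) q"
        by (simp add: epowr_def)
    qed
    also have "\<dots> = 1 + ?I"
      by (subst nn_integral_add) (auto simp: emeasure_space_1)
    also have "\<dots> < \<top>" using I by (simp add: less_top)
    finally show ?thesis .
  qed
  then show ?thesis by (simp add: integrable_iff_bounded)
qed

lemma Lp_norm_cmult_le:
  assumes h: "h \<in> borel_measurable M" and [measurable]: "g \<in> borel_measurable M"
    and c: "0 < c" and p: "1 \<le> p" and le: "AE x in M. h x \<le> ennreal c * g x"
  shows "Lp_norm M p h \<le> ennreal c * Lp_norm M p g"
proof (cases "p = \<top>")
  case True
  have "AE x in M. h x \<le> ennreal c * esssup M g"
    using le esssup_AE[of g M]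
    by eventually_elim (erule order_trans, simp add: mult_left_mono)
  then have "esssup M h \<le> ennreal c * esssup M g"
    by (rule esssup_I[OF h])
  then show ?thesis using True by (simp add: Lp_norm_def)
next
  case False
  define q where "q = enn2real p"
  have q: "1 \<le> q"
    using enn2real_mono[OF p] False by (simp add: q_def less_top)
  have "(\<integral>\<^sup>+x. epowr (h x) q \<partial>M) \<le> (\<integral>\<^sup>+x. epowr (ennreal c * g x) q \<partial>M)"
    using le by (intro nn_integral_mono_AE) (use q in \<open>auto elim!: eventually_mono intro: epowr_mono\<close>)
  also have "\<dots> = ennreal (c powr q) * (\<integral>\<^sup>+x. epowr (g x) q \<partial>M)"
    using c by (simp add: epowr_cmult nn_integral_cmult)
  finally have "epowr (\<integral>\<^sup>+x. epowr (h x) q \<partial>M) (1/q)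
      \<le> epowr (ennreal (c powr q) * (\<integral>\<^sup>+x. epowr (g x) q \<partial>M)) (1/q)"
    using q by (intro epowr_mono) auto
  also have "\<dots> = ennreal c * epowr (\<integral>\<^sup>+x. epowr (g x) q \<partial>M) (1/q)"
    using c q by (simp add: epowr_cmult powr_powr)
  finally show ?thesis using False by (simp add: Lp_norm_def q_def)
qed

text \<open>Moves the constant to the larger side, so that the lower bound also takes the form
  handled by \<open>Lp_norm_cmult_le\<close>.\<close>

lemma ennreal_cmult_le_iff:
  assumes "0 < c"
  shows "ennreal c * a \<le> b \<longleftrightarrow> a \<le> ennreal (1 / c) * b"
proof -
  have "ennreal (1 / c) * (ennreal c * a) = a" "ennreal c * (ennreal (1 / c) * b) = b"
    using assms by (simp_all flip: mult.assoc ennreal_mult)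
  then show ?thesis
    using mult_left_mono[of "ennreal c * a" b "ennreal (1 / c)"]
      mult_left_mono[of a "ennreal (1 / c) * b" "ennreal c"] by auto
qed

theorem theorem1p2:
  fixes M :: "'a measure" and A :: "nat \<Rightarrow> 'a measure"
  assumes "prob_space M"
    and "generating_filtration M A"
  shows "(\<forall>f t. f \<in> Lp_space M 1 \<and> t > 0 \<longrightarrow>
           (AE x in M.
              (\<lambda>n. ((1 - coeff_a n) powr t) *\<^sub>R mart_dE M A (Suc n) f x)
                sums semigroup_T M A t f x \<and>
              (\<lambda>n. ((1 - coeff_a n) powr t - (1 - coeff_a (Suc n)) powr t) *\<^sub>R mart_E M A (Suc n) f x)
                sums semigroup_T M A t f x))
       \<and> (\<forall>f \<in> Lp_space M 1. AE x in M.
            ennreal (sqrt (7/60)) * square_fun M A (\<lambda>y. f y - fix_proj M A f y) x \<le> G_fun M A f x \<and>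
            G_fun M A f x \<le> ennreal (sqrt (23/60)) * square_fun M A (\<lambda>y. f y - fix_proj M A f y) x)
       \<and> (\<forall>p \<ge> 1. \<forall>f \<in> Lp_space M p.
            ennreal (sqrt (7/60)) * Lp_norm M p (square_fun M A (\<lambda>y. f y - fix_proj M A f y))
              \<le> Lp_norm M p (G_fun M A f) \<and>
            Lp_norm M p (G_fun M A f)
              \<le> ennreal (sqrt (23/60)) * Lp_norm M p (square_fun M A (\<lambda>y. f y - fix_proj M A f y)))"
proof -
  note MA = assms
  let ?S = "\<lambda>f. square_fun M A (\<lambda>y. f y - fix_proj M A f y)"
  have sums: "AE x in M.
      (\<lambda>n. ((1 - coeff_a n) powr t) *\<^sub>R mart_dE M A (Suc n) f x) sums semigroup_T M A t f x \<and>
      (\<lambda>n. ((1 - coeff_a n) powr t - (1 - coeff_a (Suc n)) powr t) *\<^sub>R mart_E M A (Suc n) f x)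
        sums semigroup_T M A t f x" if "integrable M f" "0 < t" for f t
    using AE_mart_dE_growth[OF MA that(1)]
    by eventually_elim (use that(2) in \<open>auto intro: semigroup_T_sums\<close>)
  have bounds: "AE x in M. ennreal (sqrt (7/60)) * ?S f x \<le> G_fun M A f x \<and>
      G_fun M A f x \<le> ennreal (sqrt (23/60)) * ?S f x" if "integrable M f" for f
    using AE_mart_dE_growth[OF MA that] square_fun_fix_proj[OF MA that]
    by eventually_elim (auto intro: G_fun_bounds)
  have norms: "ennreal (sqrt (7/60)) * Lp_norm M p (?S f) \<le> Lp_norm M p (G_fun M A f) \<and>
      Lp_norm M p (G_fun M A f) \<le> ennreal (sqrt (23/60)) * Lp_norm M p (?S f)"
    if "integrable M f" "1 \<le> p" for f p
  proof
    \<comment> \<open>The lower bound is inverted pointwise, compared in norm, and inverted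
      back.\<close>
    have "AE x in M. ?S f x \<le> ennreal (1 / sqrt (7/60)) * G_fun M A f x"
      using bounds[OF that(1)] by eventually_elim (subst ennreal_cmult_le_iff[symmetric]; simp)
    then show "ennreal (sqrt (7/60)) * Lp_norm M p (?S f) \<le> Lp_norm M p (G_fun M A f)"
      by (subst ennreal_cmult_le_iff)
         (auto intro!: Lp_norm_cmult_le square_fun_measurable G_fun_measurable MA that)
    have "AE x in M. G_fun M A f x \<le> ennreal (sqrt (23/60)) * ?S f x"
      using bounds[OF that(1)] by eventually_elim simp
    then show "Lp_norm M p (G_fun M A f) \<le> ennreal (sqrt (23/60)) * Lp_norm M p (?S f)"
      by (intro Lp_norm_cmult_le square_fun_measurable G_fun_measurable MA that) auto
  qed
  have "integrable M f" if "f \<in> Lp_space M 1" for f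
    using Lp_space_integrable[OF MA(1) order_refl that] .
  then show ?thesis
    using sums bounds norms Lp_space_integrable[OF MA(1)] by blast
qed

end
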